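(* The following problem is decidable: given two session automata $\mathcal A$ and $\mathcal B$, decide whether $L(\mathcal A)\subseteq L(\mathcal B)$.
   Context: $\Sigma$ is a non-empty finite alphabet, $D$ an infinite set of data values; data words are elements of $(\Sigma\times D)^*$. A session automaton $(S,\mathcal R,\iota,F,\Delta)$ has finite non-empty state set $S$, finite non-empty register set $\mathcal R$, initial state $\iota$, final states $F\subseteq S$, and finitely many transitions $(s,(a,\pi),s')$ with $a\in\Sigma$, $\pi\in\{r^\circledast,r^\uparrow:r\in\mathcal R\}$. Configurations are $(s,\tau,U)$ with $\tau:\mathcal R\rightharpoonup D$ partial, $U\subseteq D$. Reading $(a,d)$ via a transition on register $r$ requires $d=\tau(r)$ if $\pi=r^\uparrow$ and $d\notin U$ (globally fresh) if $\pi=r^\circledast$; then $\tau(r):=d$, $U:=U\cup\{d\}$. Runs start in $(\iota,\emptyset,\emptyset)$; $L(\mathcal A)$ is the set of data words having a run ending in $F$. *)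

theory Defs
  imports Main "HOL-Library.Nat_Bijection"
begin

section \<open>Session automata\<close>

text \<open>\<open>Fresh r\<close> is $r^\circledast$ (globally fresh value, stored in \<open>r\<close>) and \<open>Reuse r\<close> is
  $r^\uparrow$ (current value of \<open>r\<close>).\<close>

datatype 'r reg_op = Fresh (reg: 'r) | Reuse (reg: 'r)

type_synonym ('s, 'r, 'a) transition = "'s \<times> ('a \<times> 'r reg_op) \<times> 's"

record ('s, 'r, 'a) session_aut =
  states :: "'s set"
  registers :: "'r set"
  initial :: 's
  finals :: "'s set"
  transitions :: "('s, 'r, 'a) transition set"

definition session_automaton :: "'a set \<Rightarrow> ('s, 'r, 'a) session_aut \<Rightarrow> bool" where
  "session_automaton \<Sigma> A \<longleftrightarrow>
     finite (states A) \<and> states A \<noteq> {} \<and>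
     finite (registers A) \<and> registers A \<noteq> {} \<and>
     initial A \<in> states A \<and> finals A \<subseteq> states A \<and>
     finite (transitions A) \<and>
     (\<forall>(s, (a, p), s') \<in> transitions A.
        s \<in> states A \<and> a \<in> \<Sigma> \<and> reg p \<in> registers A \<and> s' \<in> states A)"

type_synonym ('s, 'r, 'd) config = "'s \<times> ('r \<rightharpoonup> 'd) \<times> 'd set"

inductive step :: "('s, 'r, 'a) session_aut \<Rightarrow>
    ('s, 'r, 'd) config \<Rightarrow> 'a \<times> 'd \<Rightarrow> ('s, 'r, 'd) config \<Rightarrow> bool"
  for A :: "('s, 'r, 'a) session_aut" where
  fresh: "(s, (a, Fresh r), s') \<in> transitions A \<Longrightarrow> d \<notin> U \<Longrightarrow>
    step A (s, \<tau>, U) (a, d) (s', \<tau>(r \<mapsto> d), insert d U)"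
| reuse: "(s, (a, Reuse r), s') \<in> transitions A \<Longrightarrow> \<tau> r = Some d \<Longrightarrow>
    step A (s, \<tau>, U) (a, d) (s', \<tau>(r \<mapsto> d), insert d U)"

inductive run :: "('s, 'r, 'a) session_aut \<Rightarrow>
    ('s, 'r, 'd) config \<Rightarrow> ('a \<times> 'd) list \<Rightarrow> ('s, 'r, 'd) config \<Rightarrow> bool"
  for A :: "('s, 'r, 'a) session_aut" where
  Nil: "run A c [] c"
| Cons: "step A c x c' \<Longrightarrow> run A c' w c'' \<Longrightarrow> run A c (x # w) c''"

definition language ::
    "'a set \<Rightarrow> 'd set \<Rightarrow> ('s, 'r, 'a) session_aut \<Rightarrow> ('a \<times> 'd) list set" where
  "language \<Sigma> D A =
     {w \<in> lists (\<Sigma> \<times> D).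
        \<exists>s \<tau> U. run A (initial A, Map.empty, {}) w (s, \<tau>, U) \<and> s \<in> finals A}"


section \<open>Recursive functions and decidable sets\<close>

text \<open>\<open>recursive k f\<close>: on argument lists of length \<open>k\<close>, \<open>f\<close> is a total recursive function of
  arity \<open>k\<close>. Unbounded minimization is restricted to regular functions, which keeps
  all functions total. Values on lists of other lengths carry no meaning.\<close>

inductive recursive :: "nat \<Rightarrow> (nat list \<Rightarrow> nat) \<Rightarrow> bool" where
  zero: "recursive k (\<lambda>_. 0)"
| succ: "recursive 1 (\<lambda>xs. Suc (hd xs))"
| proj: "i < k \<Longrightarrow> recursive k (\<lambda>xs. xs ! i)"
| comp: "recursive (length gs) f \<Longrightarrow> (\<forall>g \<in> set gs. recursive k g) \<Longrightarrow>
    recursive k (\<lambda>xs. f (map (\<lambda>g. g xs) gs))"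
| prim_rec: "recursive k f \<Longrightarrow> recursive (Suc (Suc k)) g \<Longrightarrow>
    recursive (Suc k)
      (\<lambda>xs. rec_nat (f (tl xs)) (\<lambda>n y. g (n # y # tl xs)) (hd xs))"
| minimization: "recursive (Suc k) f \<Longrightarrow>
    (\<forall>xs. length xs = k \<longrightarrow> (\<exists>n. f (n # xs) = 0)) \<Longrightarrow>
    recursive k (\<lambda>xs. LEAST n. f (n # xs) = 0)"

definition decidable :: "nat set \<Rightarrow> bool" where
  "decidable X \<longleftrightarrow>
     (\<exists>f. recursive 1 f \<and> (\<forall>n. f [n] = (if n \<in> X then 1 else 0)))"


section \<open>Encoding session automata as natural numbers\<close>

text \<open>To be an input of an algorithm, an automaton has its states and registers named by
  natural numbers; the letters are named by \<open>e\<close>, an injective numbering of the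
  alphabet.\<close>

fun op_code :: "nat reg_op \<Rightarrow> nat" where
  "op_code (Fresh r) = sum_encode (Inl r)"
| "op_code (Reuse r) = sum_encode (Inr r)"

fun transition_code :: "('a \<Rightarrow> nat) \<Rightarrow> (nat, nat, 'a) transition \<Rightarrow> nat" where
  "transition_code e (s, (a, p), s') =
     prod_encode (s, prod_encode (prod_encode (e a, op_code p), s'))"

definition aut_code :: "('a \<Rightarrow> nat) \<Rightarrow> (nat, nat, 'a) session_aut \<Rightarrow> nat" where
  "aut_code e A =
     prod_encode (set_encode (states A),
     prod_encode (set_encode (registers A),
     prod_encode (initial A,
     prod_encode (set_encode (finals A),
       set_encode (transition_code e ` transitions A)))))"

lemma op_code_inject: "op_code p = op_code q \<longleftrightarrow> p = q"
  by (cases p; cases q) (auto simp: sum_encode_eq)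

lemma aut_code_inject:
  assumes "inj_on e \<Sigma>" "session_automaton \<Sigma> A" "session_automaton \<Sigma> B"
    and eq: "aut_code e A = aut_code e B"
  shows "A = B"
proof -
  have fin: "finite (finals A)" "finite (finals B)"
    using assms by (auto simp: session_automaton_def intro: finite_subset)
  have inj: "inj_on (transition_code e) (transitions A \<union> transitions B)"
  proof (rule inj_onI)
    fix t u
    assume "t \<in> transitions A \<union> transitions B" "u \<in> transitions A \<union> transitions B"
      and "transition_code e t = transition_code e u"
    moreover obtain s a p s' where t: "t = (s, (a, p), s')" by (metis prod.collapse)
    moreover obtain q b p' q' where u: "u = (q, (b, p'), q')" by (metis prod.collapse)
    moreover have "a \<in> \<Sigma>" "b \<in> \<Sigma>"
      using calculation assms(2,3) unfolding session_automaton_def by fast+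
    ultimately show "t = u"
      using assms(1) by (auto simp: prod_encode_eq op_code_inject dest: inj_onD)
  qed
  have "states A = states B" "registers A = registers B" "initial A = initial B"
    "finals A = finals B"
    "transition_code e ` transitions A = transition_code e ` transitions B"
    using eq fin assms(2,3)
    by (auto simp: aut_code_def session_automaton_def prod_encode_eq set_encode_eq)
  moreover from this(5) have "transitions A = transitions B"
    using inj by (metis inj_on_image_eq_iff sup_ge1 sup_ge2)
  ultimately show ?thesis by simp
qed

end

theory Submission
  imports Defs
begin

text \<open>Along a run of \<open>A\<close>, a value that was used before and is no longer stored in a register of \<open>A\<close> never
  occurs again. Hence a configuration of \<open>B\<close> on the same data word matters only through its state
  and the partial matching between registers of \<open>B\<close> and of \<open>A\<close> that hold equal values. The set of all
  such abstracted configurations of \<open>B\<close> evolves deterministically along the run of \<open>A\<close>, within a finite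
  space, and inclusion holds iff a set of these symbolic configurations exists that contains the initial
  one, is closed under transitions, and in which every final state of \<open>A\<close> comes with a final state of
  \<open>B\<close>. Under the encoding of finite sets by numbers, this is a search for a number below an explicit
  bound with a property that uses only bounded quantifiers.\<close>

section \<open>Closure properties of recursive functions\<close>

text \<open>Functions take an infinite environment of variables, of which some finite prefix matters.
  Binding a variable shifts the others to \<open>\<rho> (Suc i)\<close>, so that the closure rules below apply to
  formulas under binders by plain resolution.\<close>

definition computable :: "((nat \<Rightarrow> nat) \<Rightarrow> nat) \<Rightarrow> bool" where
  "computable f \<longleftrightarrow> (\<exists>k g. recursive k g \<and> (\<forall>\<rho>. f \<rho> = g (map \<rho> [0..<k])))"

definition computable_pred :: "((nat \<Rightarrow> nat) \<Rightarrow> bool) \<Rightarrow> bool" where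
  "computable_pred P \<longleftrightarrow> computable (\<lambda>\<rho>. of_bool (P \<rho>))"

text \<open>A witness of arity \<open>k\<close> becomes one of any larger arity by composition with
  the first \<open>k\<close> projections. This brings several functions to one common arity.\<close>

lemma computable_arity:
  assumes "computable f"
  obtains k where
    "\<And>m. k \<le> m \<Longrightarrow> \<exists>g. recursive m g \<and> (\<forall>\<rho>. f \<rho> = g (map \<rho> [0..<m]))"
proof -
  obtain k g where g: "recursive k g" "\<And>\<rho>. f \<rho> = g (map \<rho> [0..<k])"
    using assms by (auto simp: computable_def)
  have "\<exists>g. recursive m g \<and> (\<forall>\<rho>. f \<rho> = g (map \<rho> [0..<m]))" if "k \<le> m" for m
  proof -
    let ?hs = "map (\<lambda>i xs. xs ! i) [0..<k]"
    have "recursive m (\<lambda>xs. g (map (\<lambda>h. h xs) ?hs))" (is "recursive m ?g")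
      using g(1) \<open>k \<le> m\<close> by (intro recursive.comp) (auto intro!: recursive.proj)
    moreover have "map (\<lambda>h. h (map \<rho> [0..<m])) ?hs = map \<rho> [0..<k]" for \<rho> :: "nat \<Rightarrow> nat"
      using \<open>k \<le> m\<close> by (auto intro!: nth_equalityI)
    ultimately show ?thesis using g(2) by (intro exI[of _ ?g]) (simp only: simp_thms)
  qed
  then show thesis by (rule that)
qed

lemma computable_cong: "computable f \<Longrightarrow> (\<And>\<rho>. f \<rho> = g \<rho>) \<Longrightarrow> computable g"
  by (simp add: computable_def)

lemma computable_var: "computable (\<lambda>\<rho>. \<rho> i)"
  unfolding computable_def
  by (rule exI[of _ "Suc i"], rule exI[of _ "\<lambda>xs. xs ! i"])
    (auto intro: recursive.proj simp del: upt_Suc)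

text \<open>\<open>F\<close> reads only a finite prefix of its environment, so finitely many
  \<open>h i\<close> matter; these share an arity, and \<open>recursive.comp\<close>
  applies.\<close>

lemma computable_subst:
  assumes "computable F" and "\<And>i. computable (h i)"
  shows "computable (\<lambda>\<rho>. F (\<lambda>i. h i \<rho>))"
proof -
  obtain k G where G: "recursive k G" "\<And>\<rho>. F \<rho> = G (map \<rho> [0..<k])"
    using assms(1) by (auto simp: computable_def)
  have "\<forall>i. \<exists>l. \<forall>m\<ge>l. \<exists>g. recursive m g \<and> (\<forall>\<rho>. h i \<rho> = g (map \<rho> [0..<m]))"
    using computable_arity[OF assms(2)] by metis
  then obtain l where l:
    "\<And>i m. l i \<le> m \<Longrightarrow> \<exists>g. recursive m g \<and> (\<forall>\<rho>. h i \<rho> = g (map \<rho> [0..<m]))"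
    by metis
  define m where "m = (\<Sum>i<k. l i)"
  have "\<forall>i<k. l i \<le> m" unfolding m_def by (auto intro: member_le_sum)
  then have "\<forall>i. \<exists>g. i < k \<longrightarrow> recursive m g \<and> (\<forall>\<rho>. h i \<rho> = g (map \<rho> [0..<m]))"
    using l by metis
  then obtain g where g:
    "\<And>i. i < k \<Longrightarrow> recursive m (g i) \<and> (\<forall>\<rho>. h i \<rho> = g i (map \<rho> [0..<m]))"
    by metis
  have "recursive m (\<lambda>xs. G (map (\<lambda>g. g xs) (map g [0..<k])))" (is "recursive m ?g")
    using G(1) g by (intro recursive.comp) auto
  moreover have "map (\<lambda>g. g (map \<rho> [0..<m])) (map g [0..<k]) = map (\<lambda>i. h i \<rho>) [0..<k]" for \<rho>
    using g by auto
  ultimately show ?thesis using G(2) unfolding computable_def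
    by (intro exI[of _ m] exI[of _ ?g]) (simp only: simp_thms)
qed

lemma computable_shift: "computable f \<Longrightarrow> computable (\<lambda>\<rho>. f (\<lambda>i. \<rho> (Suc i)))"
  by (rule computable_subst[where h = "\<lambda>i \<rho>. \<rho> (Suc i)"]) (auto intro: computable_var)

text \<open>Turns a rule for variable 0 into one for an arbitrary term \<open>t\<close>, with the
  other variables shifted back.\<close>

lemma computable_instantiate:
  assumes "computable (\<lambda>\<rho>. F (\<rho> 0) (\<lambda>i. \<rho> (Suc i)))" and "computable t"
  shows "computable (\<lambda>\<rho>. F (t \<rho>) \<rho>)"
proof -
  have "computable (case_nat t (\<lambda>i \<rho>. \<rho> i) i)" for i
    using assms(2) by (cases i) (auto intro: computable_var)
  from computable_subst[OF assms(1), of "case_nat t (\<lambda>i \<rho>. \<rho> i)", OF this]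
  show ?thesis by simp
qed

lemma computable_unary:
  assumes "computable (\<lambda>\<rho>. F (\<rho> 0))" and "computable f"
  shows "computable (\<lambda>\<rho>. F (f \<rho>))"
  using computable_subst[OF assms(1), of "\<lambda>_. f"] assms(2) by simp

lemma map_upt_Suc_env: "map \<rho> [0..<Suc k] = \<rho> 0 # map (\<lambda>i. \<rho> (Suc i)) [0..<k]"
  by (simp add: upt_conv_Cons map_Suc_upt[symmetric] comp_def del: upt_Suc)

lemma computable_Suc:
  assumes "computable f" shows "computable (\<lambda>\<rho>. Suc (f \<rho>))"
proof -
  have "computable (\<lambda>\<rho>. Suc (\<rho> 0))"
    unfolding computable_def
    by (rule exI[of _ 1], rule exI[of _ "\<lambda>xs. Suc (hd xs)"]) (simp add: recursive.succ[simplified])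
  from computable_unary[OF this assms] show ?thesis .
qed

lemma computable_const: "computable (\<lambda>_. c)"
proof (induction c)
  case 0
  show ?case unfolding computable_def using recursive.zero by blast
qed (rule computable_Suc)

text \<open>Primitive recursion in environment form: variables 0 and 1 of the step are the counter
  and the previous value. Since \<open>prim_rec\<close> recurses on the first argument, the claim is
  reduced to recursion on variable 0.\<close>

lemma computable_rec_nat:
  assumes "computable (\<lambda>\<rho>. g (\<rho> 0) (\<rho> (Suc 0)) (\<lambda>i. \<rho> (Suc (Suc i))))"
    and "computable f" and "computable t"
  shows "computable (\<lambda>\<rho>. rec_nat (f \<rho>) (\<lambda>n y. g n y \<rho>) (t \<rho>))"
proof (rule computable_instantiate[OF _ assms(3)])
  obtain k where k: "\<And>m. k \<le> m \<Longrightarrow> \<exists>g'. recursive m g' \<and>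
      (\<forall>\<rho>. g (\<rho> 0) (\<rho> (Suc 0)) (\<lambda>i. \<rho> (Suc (Suc i))) = g' (map \<rho> [0..<m]))"
    using computable_arity[OF assms(1)] by metis
  obtain l where l: "\<And>m. l \<le> m \<Longrightarrow> \<exists>g. recursive m g \<and> (\<forall>\<rho>. f \<rho> = g (map \<rho> [0..<m]))"
    using computable_arity[OF assms(2)] by metis
  define m where "m = k + l"
  obtain f' where f': "recursive m f'" "\<And>\<rho>. f \<rho> = f' (map \<rho> [0..<m])"
    using l[of m] by (auto simp: m_def)
  obtain g' where g': "recursive (Suc (Suc m)) g'"
    "\<And>\<rho>. g (\<rho> 0) (\<rho> (Suc 0)) (\<lambda>i. \<rho> (Suc (Suc i))) = g' (map \<rho> [0..<Suc (Suc m)])"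
    using k[of "Suc (Suc m)"] by (auto simp: m_def simp del: upt_Suc)
  \<comment> \<open>Pushing \<open>y\<close> and then \<open>n\<close> onto an arbitrary environment
    exposes the first two arguments of \<open>g'\<close>.\<close>
  have g'': "g n y \<rho> = g' (n # y # map \<rho> [0..<m])" for n y \<rho>
    using g'(2)[of "case_nat n (case_nat y \<rho>)"] by (simp add: map_upt_Suc_env del: upt_Suc)
  have "rec_nat (f (\<lambda>i. \<rho> (Suc i))) (\<lambda>n y. g n y (\<lambda>i. \<rho> (Suc i))) (\<rho> 0) =
      (\<lambda>xs. rec_nat (f' (tl xs)) (\<lambda>n y. g' (n # y # tl xs)) (hd xs)) (map \<rho> [0..<Suc m])" for \<rho>
    by (simp add: map_upt_Suc_env f'(2) g'' del: upt_Suc)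
  with recursive.prim_rec[OF f'(1) g'(1)]
  show "computable (\<lambda>\<rho>. rec_nat (f (\<lambda>i. \<rho> (Suc i))) (\<lambda>n y. g n y (\<lambda>i. \<rho> (Suc i))) (\<rho> 0))"
    unfolding computable_def by blast
qed

text \<open>A recursion of length 1 or 0, given by the truth value, selects the branch.\<close>

lemma computable_if:
  assumes "computable_pred P" and "computable f" and "computable g"
  shows "computable (\<lambda>\<rho>. if P \<rho> then f \<rho> else g \<rho>)"
proof -
  have "computable (\<lambda>\<rho>. rec_nat (g \<rho>) (\<lambda>_ _. f \<rho>) (of_bool (P \<rho>)))"
    using assms by (intro computable_rec_nat computable_shift) (auto simp: computable_pred_def)
  moreover have "rec_nat (g \<rho>) (\<lambda>_ _. f \<rho>) (of_bool (P \<rho>)) = (if P \<rho> then f \<rho> else g \<rho>)" for \<rho>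
    by simp
  ultimately show ?thesis by simp
qed

section \<open>Connectives and bounded quantification\<close>

lemma computable_pred_const: "computable_pred (\<lambda>_. c)"
  unfolding computable_pred_def by (rule computable_const)

lemma computable_pred_cong:
  "computable_pred P \<Longrightarrow> (\<And>\<rho>. P \<rho> \<longleftrightarrow> Q \<rho>) \<Longrightarrow> computable_pred Q"
  by (subgoal_tac "P = Q") auto

lemma computable_pred_if:
  assumes "computable_pred P" and "computable_pred Q" and "computable_pred R"
  shows "computable_pred (\<lambda>\<rho>. if P \<rho> then Q \<rho> else R \<rho>)"
  unfolding computable_pred_def
  by (rule computable_cong, rule computable_if[OF assms(1) assms(2,3)[unfolded computable_pred_def]]) simp

lemma computable_pred_not: "computable_pred P \<Longrightarrow> computable_pred (\<lambda>\<rho>. \<not> P \<rho>)"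
  by (rule computable_pred_cong[OF computable_pred_if[OF _ computable_pred_const computable_pred_const,
      of P False True]]) auto

lemma computable_pred_conj:
  "computable_pred P \<Longrightarrow> computable_pred Q \<Longrightarrow> computable_pred (\<lambda>\<rho>. P \<rho> \<and> Q \<rho>)"
  by (rule computable_pred_cong[OF computable_pred_if[OF _ _ computable_pred_const, of P Q False]]) auto

lemma computable_pred_disj:
  "computable_pred P \<Longrightarrow> computable_pred Q \<Longrightarrow> computable_pred (\<lambda>\<rho>. P \<rho> \<or> Q \<rho>)"
  by (rule computable_pred_cong[OF computable_pred_not[OF computable_pred_conj[OF
      computable_pred_not[of P] computable_pred_not[of Q]]]]) auto

lemma computable_pred_imp:
  "computable_pred P \<Longrightarrow> computable_pred Q \<Longrightarrow> computable_pred (\<lambda>\<rho>. P \<rho> \<longrightarrow> Q \<rho>)"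
  by (rule computable_pred_cong[OF computable_pred_disj[OF computable_pred_not[of P], of Q]]) auto

lemma computable_pred_iff:
  "computable_pred P \<Longrightarrow> computable_pred Q \<Longrightarrow> computable_pred (\<lambda>\<rho>. P \<rho> \<longleftrightarrow> Q \<rho>)"
  by (rule computable_pred_cong[OF computable_pred_conj[OF computable_pred_imp[of P Q]
      computable_pred_imp[of Q P]]]) auto

lemma computable_pred_ex_less:
  assumes "computable_pred (\<lambda>\<rho>. P (\<rho> 0) (\<lambda>i. \<rho> (Suc i)))" and "computable t"
  shows "computable_pred (\<lambda>\<rho>. \<exists>y<t \<rho>. P y \<rho>)"
proof -
  \<comment> \<open>In the recursion below, variable 1 holds the accumulated truth value, which
    \<open>P\<close> has to skip.\<close>
  have "computable (\<lambda>\<rho>. of_bool (P (\<rho> 0) (\<lambda>i. \<rho> (Suc (Suc i)))))"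
    using computable_subst[OF assms(1)[unfolded computable_pred_def],
        of "case_nat (\<lambda>\<rho>. \<rho> 0) (\<lambda>i \<rho>. \<rho> (Suc (Suc i)))"]
    by (simp add: computable_var split: nat.split)
  then have "computable (\<lambda>\<rho>. rec_nat 0 (\<lambda>n y. if P n \<rho> then 1 else y) (t \<rho>))"
    using assms(2)
    by (intro computable_rec_nat computable_if computable_const computable_var)
      (simp_all add: computable_pred_def)
  moreover have "rec_nat 0 (\<lambda>n y. if P n \<rho> then 1 else y) m = of_bool (\<exists>y<m. P y \<rho>)" for m \<rho>
    by (induction m) (auto simp: less_Suc_eq)
  ultimately show ?thesis unfolding computable_pred_def by (rule computable_cong)
qed

section \<open>Arithmetic, comparison and minimization\<close>

lemma computable_add:
  assumes "computable f" and "computable g" shows "computable (\<lambda>\<rho>. f \<rho> + g \<rho>)"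
proof -
  have "computable (\<lambda>\<rho>. rec_nat (f \<rho>) (\<lambda>n y. Suc y) (g \<rho>))"
    using assms by (intro computable_rec_nat computable_Suc computable_var)
  moreover have "rec_nat a (\<lambda>n y. Suc y) b = a + b" for a b by (induction b) auto
  ultimately show ?thesis by simp
qed

lemma computable_mult:
  assumes "computable f" and "computable g" shows "computable (\<lambda>\<rho>. f \<rho> * g \<rho>)"
proof -
  have "computable (\<lambda>\<rho>. rec_nat 0 (\<lambda>n y. y + f \<rho>) (g \<rho>))"
    using assms by (intro computable_rec_nat computable_add computable_const computable_shift computable_var)
  moreover have "rec_nat 0 (\<lambda>n y. y + a) b = a * b" for a b :: nat by (induction b) auto
  ultimately show ?thesis by simp
qed

lemma computable_power:
  assumes "computable f" and "computable g" shows "computable (\<lambda>\<rho>. f \<rho> ^ g \<rho>)"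
proof -
  have "computable (\<lambda>\<rho>. rec_nat 1 (\<lambda>n y. y * f \<rho>) (g \<rho>))"
    using assms by (intro computable_rec_nat computable_mult computable_const computable_shift computable_var)
  moreover have "rec_nat 1 (\<lambda>n y. y * a) b = a ^ b" for a b :: nat by (induction b) auto
  ultimately show ?thesis by simp
qed

lemma computable_diff:
  assumes "computable f" and "computable g" shows "computable (\<lambda>\<rho>. f \<rho> - g \<rho>)"
proof -
  \<comment> \<open>Returning the counter in place of the accumulated value yields the predecessor,
    whose iteration is truncated subtraction.\<close>
  have "computable (\<lambda>\<rho>. rec_nat 0 (\<lambda>n _. n) (\<rho> 0))"
    by (intro computable_rec_nat computable_const computable_var)
  moreover have "rec_nat 0 (\<lambda>n _. n) a = a - 1" for a :: nat by (cases a) auto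
  ultimately have "computable (\<lambda>\<rho>. \<rho> 0 - 1)" by simp
  then have "computable (\<lambda>\<rho>. \<rho> (Suc 0) - 1)"
    using computable_var by (rule computable_unary)
  then have "computable (\<lambda>\<rho>. rec_nat (f \<rho>) (\<lambda>n y. y - 1) (g \<rho>))"
    using assms by (intro computable_rec_nat)
  moreover have "rec_nat a (\<lambda>n y. y - 1) b = a - b" for a b :: nat by (induction b) auto
  ultimately show ?thesis by simp
qed

lemma computable_triangle:
  assumes "computable f" shows "computable (\<lambda>\<rho>. triangle (f \<rho>))"
proof -
  have "computable (\<lambda>\<rho>. rec_nat 0 (\<lambda>n y. y + Suc n) (f \<rho>))"
    using assms by (intro computable_rec_nat computable_add computable_const computable_Suc computable_var)
  moreover have "rec_nat 0 (\<lambda>n y. y + Suc n) a = triangle a" for a by (induction a) auto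
  ultimately show ?thesis by simp
qed

lemma computable_prod_encode:
  "computable f \<Longrightarrow> computable g \<Longrightarrow> computable (\<lambda>\<rho>. prod_encode (f \<rho>, g \<rho>))"
  unfolding prod_encode_def by (simp add: computable_add computable_triangle)

lemma computable_pred_zero:
  assumes "computable f" shows "computable_pred (\<lambda>\<rho>. f \<rho> = 0)"
proof -
  have "computable (\<lambda>\<rho>. 1 - f \<rho>)" by (intro computable_diff computable_const assms)
  moreover have "1 - a = of_bool (a = 0)" for a :: nat by (cases a) auto
  ultimately show ?thesis by (simp add: computable_pred_def)
qed

lemma computable_pred_le:
  "computable f \<Longrightarrow> computable g \<Longrightarrow> computable_pred (\<lambda>\<rho>. f \<rho> \<le> g \<rho>)"
  using computable_pred_zero[OF computable_diff[of f g]] by simp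

lemma computable_pred_less:
  "computable f \<Longrightarrow> computable g \<Longrightarrow> computable_pred (\<lambda>\<rho>. f \<rho> < g \<rho>)"
  using computable_pred_le[OF computable_Suc[of f], of g] by (simp add: Suc_le_eq)

lemma computable_pred_eq:
  "computable f \<Longrightarrow> computable g \<Longrightarrow> computable_pred (\<lambda>\<rho>. f \<rho> = g \<rho>)"
  using computable_pred_conj[OF computable_pred_le[of f g] computable_pred_le[of g f]]
  by (simp add: eq_iff)

text \<open>Minimization looks for a zero, so it is applied to the indicator of the negation; the
  existence assumption supplies regularity.\<close>

lemma computable_Least:
  assumes "computable_pred (\<lambda>\<rho>. P (\<rho> 0) (\<lambda>i. \<rho> (Suc i)))" and "\<And>\<rho>. \<exists>n. P n \<rho>"
  shows "computable (\<lambda>\<rho>. LEAST n. P n \<rho>)"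
proof -
  have "computable (\<lambda>\<rho>. of_bool (\<not> P (\<rho> 0) (\<lambda>i. \<rho> (Suc i))))"
    using computable_pred_not[OF assms(1)] by (simp add: computable_pred_def)
  then obtain k where k: "\<And>m. k \<le> m \<Longrightarrow> \<exists>g. recursive m g \<and>
      (\<forall>\<rho>. of_bool (\<not> P (\<rho> 0) (\<lambda>i. \<rho> (Suc i))) = g (map \<rho> [0..<m]))"
    using computable_arity by blast
  obtain g where g: "recursive (Suc k) g"
    "\<And>\<rho>. of_bool (\<not> P (\<rho> 0) (\<lambda>i. \<rho> (Suc i))) = g (map \<rho> [0..<Suc k])"
    using k[of "Suc k"] by (auto simp del: upt_Suc)
  have g': "g (n # map \<rho> [0..<k]) = of_bool (\<not> P n \<rho>)" for n \<rho>
    using g(2)[of "case_nat n \<rho>"] by (simp add: map_upt_Suc_env del: upt_Suc)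
  \<comment> \<open>The list \<open>xs\<close> is read as the environment \<open>(!) xs\<close>. Its
    values from position \<open>k\<close> on are unspecified, but only the first \<open>k\<close>
    entries reach \<open>g\<close>.\<close>
  have "\<exists>n. g (n # xs) = 0" if "length xs = k" for xs
    using g'[of _ "(!) xs"] assms(2)[of "(!) xs"] that by (auto simp: map_nth)
  then have "recursive k (\<lambda>xs. LEAST n. g (n # xs) = 0)"
    using g(1) by (intro recursive.minimization) auto
  then show ?thesis unfolding computable_def
    by (intro exI[of _ k] exI conjI) (auto simp: g')
qed

section \<open>Decoding of pairs and finite sets\<close>

abbreviation pfst :: "nat \<Rightarrow> nat" where "pfst n \<equiv> fst (prod_decode n)"
abbreviation psnd :: "nat \<Rightarrow> nat" where "psnd n \<equiv> snd (prod_decode n)"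

lemma prod_encode_pfst_psnd: "prod_encode (pfst n, psnd n) = n"
  by simp

text \<open>Every number codes exactly one pair, and no component exceeds the code. So the first
  component is found by minimization, with the second one bounded.\<close>

lemma computable_pfst:
  assumes "computable f" shows "computable (\<lambda>\<rho>. pfst (f \<rho>))"
proof -
  have "computable (\<lambda>\<rho>. LEAST x. \<exists>y<Suc (\<rho> 0). prod_encode (x, y) = \<rho> 0)"
  proof (rule computable_Least)
    show "computable_pred (\<lambda>\<rho>. \<exists>y<Suc (\<rho> (Suc 0)). prod_encode (\<rho> 0, y) = \<rho> (Suc 0))"
      by (intro computable_pred_ex_less computable_pred_eq computable_prod_encode computable_Suc computable_var)
    show "\<exists>x. \<exists>y<Suc (\<rho> 0). prod_encode (x, y) = \<rho> 0" for \<rho>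
      by (metis le_imp_less_Suc le_prod_encode_2 prod_encode_pfst_psnd)
  qed
  moreover have "(LEAST x. \<exists>y<Suc m. prod_encode (x, y) = m) = pfst m" for m
  proof -
    have "(\<exists>y<Suc m. prod_encode (x, y) = m) \<longleftrightarrow> x = pfst m" for x
      by (metis fst_conv le_imp_less_Suc le_prod_encode_2 prod_encode_inverse prod_encode_pfst_psnd)
    then show ?thesis by (intro Least_equality) simp_all
  qed
  ultimately have "computable (\<lambda>\<rho>. pfst (\<rho> 0))" by simp
  then show ?thesis using assms by (rule computable_unary)
qed

lemma computable_psnd:
  assumes "computable f" shows "computable (\<lambda>\<rho>. psnd (f \<rho>))"
proof -
  have "computable (\<lambda>\<rho>. LEAST y. prod_encode (pfst (\<rho> 0), y) = \<rho> 0)"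
  proof (rule computable_Least)
    show "computable_pred (\<lambda>\<rho>. prod_encode (pfst (\<rho> (Suc 0)), \<rho> 0) = \<rho> (Suc 0))"
      by (intro computable_pred_eq computable_prod_encode computable_pfst computable_var)
    show "\<exists>y. prod_encode (pfst (\<rho> 0), y) = \<rho> 0" for \<rho>
      by (metis prod_encode_pfst_psnd)
  qed
  moreover have "(LEAST y. prod_encode (pfst m, y) = m) = psnd m" for m
  proof -
    have "prod_encode (pfst m, y) = m \<longleftrightarrow> y = psnd m" for y
      by (metis snd_conv prod_encode_inverse prod_encode_pfst_psnd)
    then show ?thesis by (intro Least_equality) simp_all
  qed
  ultimately have "computable (\<lambda>\<rho>. psnd (\<rho> 0))" by simp
  then show ?thesis using assms by (rule computable_unary)
qed

lemma computable_div2: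
  assumes "computable f" shows "computable (\<lambda>\<rho>. f \<rho> div 2)"
proof -
  have "computable (\<lambda>\<rho>. LEAST q. \<rho> 0 < 2 * q + 2)"
  proof (rule computable_Least)
    show "computable_pred (\<lambda>\<rho>. \<rho> (Suc 0) < 2 * \<rho> 0 + 2)"
      by (intro computable_pred_less computable_add computable_mult computable_const computable_var)
    show "\<exists>q. \<rho> 0 < 2 * q + 2" for \<rho> :: "nat \<Rightarrow> nat"
      by (rule exI[of _ "\<rho> 0"]) simp
  qed
  moreover have "(LEAST q. m < 2 * q + 2) = m div 2" for m :: nat
    by (rule Least_equality) auto
  ultimately have "computable (\<lambda>\<rho>. \<rho> 0 div 2)" by simp
  then show ?thesis using assms by (rule computable_unary)
qed

lemma computable_pred_even:
  assumes "computable f" shows "computable_pred (\<lambda>\<rho>. even (f \<rho>))"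
proof -
  have "computable_pred (\<lambda>\<rho>. 2 * (f \<rho> div 2) = f \<rho>)"
    by (intro computable_pred_eq computable_mult computable_div2 computable_const assms)
  moreover have "2 * (m div 2) = m \<longleftrightarrow> even m" for m :: nat
    by (metis dvd_mult_div_cancel dvd_triv_left)
  ultimately show ?thesis by simp
qed

text \<open>Membership is a test of one binary digit: halve as often as the position says, then
  check for oddness.\<close>

lemma computable_pred_mem_set_decode:
  assumes "computable f" and "computable g"
  shows "computable_pred (\<lambda>\<rho>. f \<rho> \<in> set_decode (g \<rho>))"
proof -
  have "computable (\<lambda>\<rho>. rec_nat (g \<rho>) (\<lambda>_ y. y div 2) (f \<rho>))"
    by (intro computable_rec_nat computable_div2 computable_var assms)
  moreover have "rec_nat m (\<lambda>_ y. y div 2) i = m div 2 ^ i" for m i :: nat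
    by (induction i) (auto simp: div_mult2_eq[symmetric] mult.commute)
  ultimately have "computable_pred (\<lambda>\<rho>. \<not> even (g \<rho> div 2 ^ f \<rho>))"
    by (intro computable_pred_not computable_pred_even) simp
  then show ?thesis by (simp add: set_decode_def)
qed

text \<open>A binary digit 1 at position \<open>i\<close> gives \<open>i < 2 ^ i\<close> and
  \<open>2 ^ i \<le> n\<close>. Thus quantification over a decoded set is bounded
  quantification.\<close>

lemma mem_set_decode_less: "i \<in> set_decode n \<Longrightarrow> i < n"
  by (metis div_less even_zero less_exp linorder_not_less mem_Collect_eq order_le_less_trans
      order_less_le_trans set_decode_def)

lemma computable_pred_bex_set_decode:
  assumes "computable_pred (\<lambda>\<rho>. P (\<rho> 0) (\<lambda>i. \<rho> (Suc i)))" and "computable t"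
  shows "computable_pred (\<lambda>\<rho>. \<exists>y\<in>set_decode (t \<rho>). P y \<rho>)"
proof -
  have "computable_pred (\<lambda>\<rho>. \<exists>y<t \<rho>. y \<in> set_decode (t \<rho>) \<and> P y \<rho>)"
    by (intro computable_pred_ex_less computable_pred_conj computable_pred_mem_set_decode
        computable_var computable_shift assms)
  moreover have "(\<exists>y<n. y \<in> set_decode n \<and> P y \<rho>) \<longleftrightarrow> (\<exists>y\<in>set_decode n. P y \<rho>)" for n \<rho>
    using mem_set_decode_less by blast
  ultimately show ?thesis by simp
qed

lemma computable_pred_ball_set_decode:
  assumes "computable_pred (\<lambda>\<rho>. P (\<rho> 0) (\<lambda>i. \<rho> (Suc i)))" and "computable t"
  shows "computable_pred (\<lambda>\<rho>. \<forall>y\<in>set_decode (t \<rho>). P y \<rho>)"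
  using computable_pred_not[OF computable_pred_bex_set_decode[OF computable_pred_not[OF assms(1)] assms(2)]]
  by simp

lemma decidable_if_computable_pred:
  assumes "computable_pred (\<lambda>\<rho>. \<rho> 0 \<in> X)" shows "decidable X"
proof -
  obtain k where k: "\<And>m. k \<le> m \<Longrightarrow> \<exists>g. recursive m g \<and>
      (\<forall>\<rho>. of_bool (\<rho> 0 \<in> X) = g (map \<rho> [0..<m]))"
    using computable_arity[OF assms[unfolded computable_pred_def]] by metis
  obtain g where g: "recursive (Suc k) g"
      "\<And>\<rho>. of_bool (\<rho> 0 \<in> X) = g (map \<rho> [0..<Suc k])"
    using k[OF le_SucI[OF order_refl]] by blast
  \<comment> \<open>The single argument is copied into every slot, which amounts to a constant
    environment; the predicate depends on variable 0 only.\<close>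
  let ?hs = "replicate (Suc k) (\<lambda>xs::nat list. xs ! 0)"
  have "recursive 1 (\<lambda>xs. g (map (\<lambda>h. h xs) ?hs))"
    using g(1) recursive.proj[of 0 1] by (intro recursive.comp) auto
  moreover have "map (\<lambda>h. h [n]) ?hs = map (\<lambda>_. n) [0..<Suc k]" for n
    by (simp add: map_replicate_const del: upt_Suc)
  then have "g (map (\<lambda>h. h [n]) ?hs) = (if n \<in> X then 1 else 0)" for n
    using g(2)[of "\<lambda>_. n", symmetric] by (simp del: upt_Suc)
  ultimately show ?thesis unfolding decidable_def by blast
qed

section \<open>Symbolic simulation\<close>

text \<open>Runs grow at the front by definition, whereas the invariants below follow prefixes of
  the word and need growth at the end.\<close>

lemma run_snoc:
  "run A c (w @ [x]) c'' \<longleftrightarrow> (\<exists>c'. run A c w c' \<and> step A c' x c'')"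
proof
  assume "run A c (w @ [x]) c''"
  then show "\<exists>c'. run A c w c' \<and> step A c' x c''"
  proof (induction w arbitrary: c)
    case Nil
    then show ?case by (auto elim!: run.cases[of A _ "_ # _"] elim: run.cases[of A _ "[]"] intro: run.Nil)
  next
    case (Cons y w)
    then show ?case by (auto elim!: run.cases[of A _ "_ # _"] intro: run.Cons) (metis run.Cons)
  qed
next
  assume "\<exists>c'. run A c w c' \<and> step A c' x c''"
  then obtain c' where "run A c w c'" "step A c' x c''" by blast
  then show "run A c (w @ [x]) c''"
    by (induction rule: run.induct) (auto intro: run.intros)
qed

lemma run_Nil_iff: "run A c [] c' \<longleftrightarrow> c' = c"
  by (auto elim: run.cases intro: run.Nil)

lemma step_iff:
  "step A (s, \<tau>, U) (a, d) (s', \<tau>', U') \<longleftrightarrow>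
    (\<exists>p. (s, (a, p), s') \<in> transitions A \<and> \<tau>' = \<tau>(reg p \<mapsto> d) \<and> U' = insert d U \<and>
      (if is_Fresh p then d \<notin> U else \<tau> (reg p) = Some d))"
proof
  assume "step A (s, \<tau>, U) (a, d) (s', \<tau>', U')"
  then show "\<exists>p. (s, (a, p), s') \<in> transitions A \<and> \<tau>' = \<tau>(reg p \<mapsto> d) \<and> U' = insert d U \<and>
      (if is_Fresh p then d \<notin> U else \<tau> (reg p) = Some d)"
    by cases force+
next
  assume "\<exists>p. (s, (a, p), s') \<in> transitions A \<and> \<tau>' = \<tau>(reg p \<mapsto> d) \<and> U' = insert d U \<and>
      (if is_Fresh p then d \<notin> U else \<tau> (reg p) = Some d)"
  then obtain p where "(s, (a, p), s') \<in> transitions A" "\<tau>' = \<tau>(reg p \<mapsto> d)" "U' = insert d U"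
      "if is_Fresh p then d \<notin> U else \<tau> (reg p) = Some d" by blast
  then show "step A (s, \<tau>, U) (a, d) (s', \<tau>', U')"
    by (cases p) (auto intro: step.intros)
qed

text \<open>As \<open>U\<close> is determined by the data word alone, two automata reading the same
  word agree on which values are fresh.\<close>

lemma run_used_values:
  "run A (initial A, Map.empty, {}) w (s, \<tau>, U) \<Longrightarrow> U = snd ` set w \<and> ran \<tau> \<subseteq> U"
proof (induction w arbitrary: s \<tau> U rule: rev_induct)
  case Nil
  then show ?case by (simp add: run_Nil_iff)
next
  case (snoc x w)
  obtain a d where "x = (a, d)" by (cases x)
  with snoc.prems obtain s0 \<tau>0 U0 p where
    "run A (initial A, Map.empty, {}) w (s0, \<tau>0, U0)" "\<tau> = \<tau>0(p \<mapsto> d)" "U = insert d U0"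
    by (auto simp: run_snoc step_iff)
  with snoc.IH[OF this(1)] \<open>x = (a, d)\<close> show ?case
    by (auto simp: ran_def split: if_splits)
qed

text \<open>A symbolic configuration \<open>(s, R, P)\<close> describes a run of \<open>A\<close> that ends in \<open>s\<close> with exactly the
  registers \<open>R\<close> filled, together with the possible ends \<open>(q, \<sigma>)\<close> of runs of \<open>B\<close> on the same data word,
  where \<open>(x, y) \<in> \<sigma>\<close> says that register \<open>x\<close> of \<open>B\<close> and register \<open>y\<close> of \<open>A\<close> hold the same value.\<close>

definition match_update :: "'r reg_op \<Rightarrow> 'p reg_op \<Rightarrow> ('p \<times> 'r) set \<Rightarrow> ('p \<times> 'r) set" where
  "match_update p p' \<sigma> =
     insert (reg p', reg p) {(x, y) \<in> \<sigma>. is_Fresh p \<longrightarrow> x \<noteq> reg p' \<and> y \<noteq> reg p}"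

text \<open>Both automata have seen the same values, so only a fresh operation can answer a fresh
  one. For a reuse, the two registers must already be matched.\<close>

definition match_enabled :: "'r reg_op \<Rightarrow> 'p reg_op \<Rightarrow> ('p \<times> 'r) set \<Rightarrow> bool" where
  "match_enabled p p' \<sigma> \<longleftrightarrow>
     (is_Fresh p' \<longleftrightarrow> is_Fresh p) \<and> (is_Fresh p \<or> (reg p', reg p) \<in> \<sigma>)"

text \<open>The inclusions are one-sided on purpose: \<open>R\<close> may be too large, \<open>P\<close> and the matchings in it
  too small. Each condition then quantifies only over elements of coded sets.\<close>

definition simulation_invariant ::
    "('s, 'r, 'a) session_aut \<Rightarrow> ('q, 'p, 'a) session_aut \<Rightarrow>
     ('s \<times> 'r set \<times> ('q \<times> ('p \<times> 'r) set) set) set \<Rightarrow> bool" where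
  "simulation_invariant A B X \<longleftrightarrow>
     (\<exists>(s, R, P)\<in>X. s = initial A \<and> (\<forall>(q, \<sigma>)\<in>P. q = initial B \<and> \<sigma> = {})) \<and>
     (\<forall>(s, R, P)\<in>X. s \<in> finals A \<longrightarrow> (\<exists>(q, \<sigma>)\<in>P. q \<in> finals B)) \<and>
     (\<forall>(s, R, P)\<in>X. \<forall>(s1, (a, p), s2)\<in>transitions A.
        s1 = s \<longrightarrow> is_Fresh p \<or> reg p \<in> R \<longrightarrow>
        (\<exists>(s', R', P')\<in>X. s' = s2 \<and> insert (reg p) R \<subseteq> R' \<and>
          (\<forall>(q', \<sigma>')\<in>P'. \<exists>(q, \<sigma>)\<in>P. \<exists>(q1, (b, p'), q2)\<in>transitions B.
             q1 = q \<and> b = a \<and> q2 = q' \<and> match_enabled p p' \<sigma> \<and> \<sigma>' \<subseteq> match_update p p' \<sigma>)))"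

section \<open>Soundness of simulation invariants\<close>

text \<open>Induction on the word from its end. Since \<open>R\<close> contains all filled
  registers, the closure clause covers each step of \<open>A\<close>; since matched registers hold
  equal values, the transitions it offers for \<open>B\<close> can be executed.\<close>

lemma simulation_invariant_run:
  assumes X: "simulation_invariant A B X"
    and "run A (initial A, Map.empty, {}) w (s, \<tau>, U)"
  shows "\<exists>R P. (s, R, P) \<in> X \<and> dom \<tau> \<subseteq> R \<and>
    (\<forall>(q, \<sigma>)\<in>P. \<exists>\<tau>'. run B (initial B, Map.empty, {}) w (q, \<tau>', U) \<and>
      (\<forall>(x, y)\<in>\<sigma>. \<tau>' x = \<tau> y))"
  using assms(2)
proof (induction w arbitrary: s \<tau> U rule: rev_induct)
  case Nil
  then have "s = initial A" "\<tau> = Map.empty" "U = {}" by (auto simp: run_Nil_iff)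
  moreover obtain R P where "(initial A, R, P) \<in> X" "\<forall>(q, \<sigma>)\<in>P. q = initial B \<and> \<sigma> = {}"
    using X unfolding simulation_invariant_def by fast
  ultimately show ?case
    by (intro exI[of _ R] exI[of _ P]) (auto simp: run_Nil_iff)
next
  case (snoc x w)
  obtain a d where x: "x = (a, d)" by (cases x)
  from snoc.prems obtain s0 \<tau>0 U0 p where
    run0: "run A (initial A, Map.empty, {}) w (s0, \<tau>0, U0)" and
    tr: "(s0, (a, p), s) \<in> transitions A" "\<tau> = \<tau>0(reg p \<mapsto> d)" "U = insert d U0"
      "if is_Fresh p then d \<notin> U0 else \<tau>0 (reg p) = Some d"
    by (auto simp: run_snoc step_iff x)
  from snoc.IH[OF run0] obtain R P where RP: "(s0, R, P) \<in> X" "dom \<tau>0 \<subseteq> R"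
    and sim: "\<forall>(q, \<sigma>)\<in>P. \<exists>\<tau>'. run B (initial B, Map.empty, {}) w (q, \<tau>', U0) \<and>
      (\<forall>(x, y)\<in>\<sigma>. \<tau>' x = \<tau>0 y)" by blast
  have "is_Fresh p \<or> reg p \<in> R" using tr(4) RP(2) by (auto split: if_splits)
  then have "\<exists>(s', R', P')\<in>X. s' = s \<and> insert (reg p) R \<subseteq> R' \<and>
          (\<forall>(q', \<sigma>')\<in>P'. \<exists>(q, \<sigma>)\<in>P. \<exists>(q1, (b, p'), q2)\<in>transitions B.
             q1 = q \<and> b = a \<and> q2 = q' \<and> match_enabled p p' \<sigma> \<and> \<sigma>' \<subseteq> match_update p p' \<sigma>)"
    using X tr(1) RP(1) unfolding simulation_invariant_def by fast
  then obtain R' P' where R'P': "(s, R', P') \<in> X" "insert (reg p) R \<subseteq> R'"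
    and step_sim: "\<And>q' \<sigma>'. (q', \<sigma>') \<in> P' \<Longrightarrow> \<exists>q \<sigma> p'. (q, \<sigma>) \<in> P \<and> (q, (a, p'), q') \<in> transitions B \<and>
             match_enabled p p' \<sigma> \<and> \<sigma>' \<subseteq> match_update p p' \<sigma>"
    by fast
  have "\<exists>\<tau>'. run B (initial B, Map.empty, {}) (w @ [x]) (q', \<tau>', U) \<and> (\<forall>(x, y)\<in>\<sigma>'. \<tau>' x = \<tau> y)"
    if q': "(q', \<sigma>') \<in> P'" for q' \<sigma>'
  proof -
    obtain q \<sigma> p' where B: "(q, \<sigma>) \<in> P" "(q, (a, p'), q') \<in> transitions B"
      "match_enabled p p' \<sigma>" "\<sigma>' \<subseteq> match_update p p' \<sigma>" using step_sim[OF q'] by blast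
    obtain \<tau>' where \<tau>': "run B (initial B, Map.empty, {}) w (q, \<tau>', U0)"
      "\<forall>(x, y)\<in>\<sigma>. \<tau>' x = \<tau>0 y" using sim B(1) by blast
    \<comment> \<open>A fresh \<open>d\<close> lies outside \<open>U0\<close>, the used set of
      \<open>B\<close> as well; a reused \<open>d\<close> is stored in \<open>reg p\<close> and, by
      the matched pair, in \<open>reg p'\<close>.\<close>
    have "if is_Fresh p' then d \<notin> U0 else \<tau>' (reg p') = Some d"
      using tr(4) B(3) \<tau>'(2) by (auto simp: match_enabled_def split: if_splits)
    then have "step B (q, \<tau>', U0) x (q', \<tau>'(reg p' \<mapsto> d), U)"
      unfolding x step_iff using B(2) tr(3) by blast
    then have "run B (initial B, Map.empty, {}) (w @ [x]) (q', \<tau>'(reg p' \<mapsto> d), U)"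
      using \<tau>'(1) by (auto simp: run_snoc)
    moreover have "\<forall>(x, y)\<in>\<sigma>'. (\<tau>'(reg p' \<mapsto> d)) x = \<tau> y"
    proof clarify
      fix x y assume "(x, y) \<in> \<sigma>'"
      then consider "x = reg p'" "y = reg p" | "(x, y) \<in> \<sigma>" "is_Fresh p \<longrightarrow> x \<noteq> reg p' \<and> y \<noteq> reg p"
        using B(4) by (auto simp: match_update_def)
      then show "(\<tau>'(reg p' \<mapsto> d)) x = \<tau> y"
      proof cases
        case 1
        then show ?thesis by (simp add: tr(2))
      next
        case 2
        have "\<tau>' x = \<tau>0 y" using \<tau>'(2) 2(1) by auto
        \<comment> \<open>A reuse writes back the stored value, so a retained pair may mention
          updated registers. A fresh step retains no such pair.\<close>
        moreover have "\<tau>' (reg p') = Some d \<and> \<tau>0 (reg p) = Some d" if "\<not> is_Fresh p"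
          using that tr(4) B(3) \<tau>'(2) by (auto simp: match_enabled_def)
        ultimately show ?thesis using 2(2) by (cases "is_Fresh p") (auto simp: tr(2))
      qed
    qed
    ultimately show ?thesis by blast
  qed
  moreover have "dom \<tau> \<subseteq> R'" using tr(2) RP(2) R'P'(2) by auto
  ultimately show ?case using R'P'(1) by blast
qed

lemma language_subset_if_simulation_invariant:
  assumes "simulation_invariant A B X"
  shows "language \<Sigma> D A \<subseteq> language \<Sigma> D B"
proof
  fix w assume "w \<in> language \<Sigma> D A"
  then obtain s \<tau> U where w: "w \<in> lists (\<Sigma> \<times> D)" "s \<in> finals A"
    and run: "run A (initial A, Map.empty, {}) w (s, \<tau>, U)" by (auto simp: language_def)
  obtain R P where P: "(s, R, P) \<in> X" and
    "\<forall>(q, \<sigma>)\<in>P. \<exists>\<tau>'. run B (initial B, Map.empty, {}) w (q, \<tau>', U)"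
    using simulation_invariant_run[OF assms run] by fast
  moreover have "\<exists>(q, \<sigma>)\<in>P. q \<in> finals B"
    using assms P w(2) unfolding simulation_invariant_def by fast
  ultimately show "w \<in> language \<Sigma> D B" using w(1) by (fastforce simp: language_def)
qed

section \<open>Completeness: the reachable symbolic configurations\<close>

text \<open>A subset construction for \<open>B\<close> along the transitions of \<open>A\<close>:
  \<open>P\<close> gathers all successors at once, with exact updates where the invariant has
  inclusions.\<close>

inductive_set symbolic_configs ::
    "('s, 'r, 'a) session_aut \<Rightarrow> ('q, 'p, 'a) session_aut \<Rightarrow>
     ('s \<times> 'r set \<times> ('q \<times> ('p \<times> 'r) set) set) set"
  for A :: "('s, 'r, 'a) session_aut" and B :: "('q, 'p, 'a) session_aut" where
  init: "(initial A, {}, {(initial B, {})}) \<in> symbolic_configs A B"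
| step: "(s, R, P) \<in> symbolic_configs A B \<Longrightarrow> (s, (a, p), s') \<in> transitions A \<Longrightarrow>
    is_Fresh p \<or> reg p \<in> R \<Longrightarrow>
    (s', insert (reg p) R, {(q', match_update p p' \<sigma>) | q \<sigma> p' q'. (q, \<sigma>) \<in> P \<and>
       (q, (a, p'), q') \<in> transitions B \<and> match_enabled p p' \<sigma>}) \<in> symbolic_configs A B"

text \<open>A realizing word is built along the derivation: the infinite \<open>D\<close> supplies
  fresh values, and the registers in \<open>R\<close> supply reused ones. The clause
  \<open>\<tau> y \<noteq> None\<close> keeps two empty registers from counting as matched.\<close>

lemma symbolic_configs_run:
  assumes A: "session_automaton \<Sigma> A" and D: "infinite D"
    and "(s, R, P) \<in> symbolic_configs A B"
  shows "\<exists>w \<tau> U. w \<in> lists (\<Sigma> \<times> D) \<and> run A (initial A, Map.empty, {}) w (s, \<tau>, U) \<and>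
    R \<subseteq> dom \<tau> \<and>
    (\<forall>q \<tau>' U'. run B (initial B, Map.empty, {}) w (q, \<tau>', U') \<longrightarrow>
      (q, {(x, y). \<tau>' x = \<tau> y \<and> \<tau> y \<noteq> None}) \<in> P)"
  using assms(3)
proof (induction rule: symbolic_configs.induct)
  case init
  show ?case
    by (rule exI[of _ "[]"]) (auto simp: run_Nil_iff)
next
  case (step s R P a p s')
  then obtain w \<tau> U where w: "w \<in> lists (\<Sigma> \<times> D)"
    and run: "run A (initial A, Map.empty, {}) w (s, \<tau>, U)" and R: "R \<subseteq> dom \<tau>"
    and B: "\<And>q \<tau>' U'. run B (initial B, Map.empty, {}) w (q, \<tau>', U') \<Longrightarrow>
      (q, {(x, y). \<tau>' x = \<tau> y \<and> \<tau> y \<noteq> None}) \<in> P"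
    by blast
  have U: "U = snd ` set w" "ran \<tau> \<subseteq> U" using run_used_values[OF run] by auto
  then have "finite U" "U \<subseteq> D" using w by auto
  obtain d where d: "d \<in> D" "if is_Fresh p then d \<notin> U else \<tau> (reg p) = Some d"
  proof (cases "is_Fresh p")
    case True
    then show thesis using that D \<open>finite U\<close> by (metis finite_subset subsetI)
  next
    case False
    then obtain d where "\<tau> (reg p) = Some d" using step.hyps R by blast
    then show thesis using that False U(2) \<open>U \<subseteq> D\<close> by (metis ranI subset_iff)
  qed
  let ?\<tau> = "\<tau>(reg p \<mapsto> d)"
  have "a \<in> \<Sigma>" using A step.hyps(2) unfolding session_automaton_def by fast
  then have "w @ [(a, d)] \<in> lists (\<Sigma> \<times> D)" using w d(1) by auto
  moreover have "run A (initial A, Map.empty, {}) (w @ [(a, d)]) (s', ?\<tau>, insert d U)"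
    using run d(2) step.hyps(2) unfolding run_snoc
    by (intro exI[of _ "(s, \<tau>, U)"]) (auto simp: step_iff)
  moreover have "insert (reg p) R \<subseteq> dom ?\<tau>" using R by auto
  moreover have "(q', {(x, y). \<tau>'' x = ?\<tau> y \<and> ?\<tau> y \<noteq> None}) \<in>
      {(q', match_update p p' \<sigma>) | q \<sigma> p' q'. (q, \<sigma>) \<in> P \<and>
       (q, (a, p'), q') \<in> transitions B \<and> match_enabled p p' \<sigma>}"
    if runB: "run B (initial B, Map.empty, {}) (w @ [(a, d)]) (q', \<tau>'', U'')" for q' \<tau>'' U''
  proof -
    obtain q \<tau>' U' p' where
      run': "run B (initial B, Map.empty, {}) w (q, \<tau>', U')" and
      tr: "(q, (a, p'), q') \<in> transitions B" "\<tau>'' = \<tau>'(reg p' \<mapsto> d)"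
        "if is_Fresh p' then d \<notin> U' else \<tau>' (reg p') = Some d"
      using runB by (auto simp: run_snoc step_iff)
    let ?\<sigma> = "{(x, y). \<tau>' x = \<tau> y \<and> \<tau> y \<noteq> None}"
    have U': "U' = U" "ran \<tau>' \<subseteq> U" using run_used_values[OF run'] U by auto
    \<comment> \<open>Whether \<open>d \<in> U\<close> decides the kind of operation for both
      automata, since stored values are used values.\<close>
    have "is_Fresh p' \<longleftrightarrow> is_Fresh p"
      using d(2) tr(3) U' U(2) by (auto simp: ran_def split: if_splits)
    then have en: "match_enabled p p' ?\<sigma>"
      using d(2) tr(3) by (auto simp: match_enabled_def split: if_splits)
    have "{(x, y). \<tau>'' x = ?\<tau> y \<and> ?\<tau> y \<noteq> None} = match_update p p' ?\<sigma>"
    proof (cases "is_Fresh p")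
      case True
      \<comment> \<open>No register held \<open>d\<close> before, so the overwriting destroys all
        pairs that mention \<open>reg p'\<close> or \<open>reg p\<close> and creates only the pair
        of these two.\<close>
      then have "\<tau> y \<noteq> Some d" "\<tau>' y' \<noteq> Some d" for y y'
        using d(2) U(2) U'(2) by (auto simp: ran_def)
      then show ?thesis using True
        by (auto simp: match_update_def tr(2) split: if_splits)
    next
      case False
      \<comment> \<open>Both assignments stay the same, and the inserted pair was already
        present.\<close>
      then have "?\<tau> = \<tau>" "\<tau>'' = \<tau>'" using d(2) tr(2,3) \<open>is_Fresh p' \<longleftrightarrow> is_Fresh p\<close> by auto
      then show ?thesis using False en by (auto simp: match_update_def match_enabled_def)
    qed
    then show ?thesis using B[OF run'] tr(1) en by blast
  qed
  ultimately show ?case by blast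
qed

text \<open>Language inclusion enters through the final states: a word realizing a final
  configuration is accepted by \<open>A\<close>, hence by \<open>B\<close>, and \<open>P\<close>
  records the accepting run of \<open>B\<close>. The other clauses hold by construction.\<close>

lemma simulation_invariant_symbolic_configs:
  assumes "session_automaton \<Sigma> A" and "infinite D"
    and "language \<Sigma> D A \<subseteq> language \<Sigma> D B"
  shows "simulation_invariant A B (symbolic_configs A B)"
  unfolding simulation_invariant_def
proof (intro conjI)
  show "\<exists>(s, R, P)\<in>symbolic_configs A B. s = initial A \<and> (\<forall>(q, \<sigma>)\<in>P. q = initial B \<and> \<sigma> = {})"
    using symbolic_configs.init by (rule rev_bexI) simp
  show "\<forall>(s, R, P)\<in>symbolic_configs A B. s \<in> finals A \<longrightarrow> (\<exists>(q, \<sigma>)\<in>P. q \<in> finals B)"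
  proof clarify
    fix s R P assume "(s, R, P) \<in> symbolic_configs A B" and fin: "s \<in> finals A"
    from symbolic_configs_run[OF assms(1,2) this(1)] obtain w \<tau> U where
      w: "w \<in> lists (\<Sigma> \<times> D)" "run A (initial A, Map.empty, {}) w (s, \<tau>, U)" and
      B: "\<And>q \<tau>' U'. run B (initial B, Map.empty, {}) w (q, \<tau>', U') \<Longrightarrow>
        (q, {(x, y). \<tau>' x = \<tau> y \<and> \<tau> y \<noteq> None}) \<in> P"
      by blast
    have "w \<in> language \<Sigma> D B" using w fin by (intro subsetD[OF assms(3)]) (auto simp: language_def)
    then obtain q \<tau>' U' where "run B (initial B, Map.empty, {}) w (q, \<tau>', U')" "q \<in> finals B"
      by (auto simp: language_def)
    with B[OF this(1)] show "\<exists>(q, \<sigma>)\<in>P. q \<in> finals B" by blast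
  qed
  show "\<forall>(s, R, P)\<in>symbolic_configs A B. \<forall>(s1, (a, p), s2)\<in>transitions A.
        s1 = s \<longrightarrow> is_Fresh p \<or> reg p \<in> R \<longrightarrow>
        (\<exists>(s', R', P')\<in>symbolic_configs A B. s' = s2 \<and> insert (reg p) R \<subseteq> R' \<and>
          (\<forall>(q', \<sigma>')\<in>P'. \<exists>(q, \<sigma>)\<in>P. \<exists>(q1, (b, p'), q2)\<in>transitions B.
             q1 = q \<and> b = a \<and> q2 = q' \<and> match_enabled p p' \<sigma> \<and> \<sigma>' \<subseteq> match_update p p' \<sigma>))"
  proof clarify
    fix s R P a p s2
    assume "(s, R, P) \<in> symbolic_configs A B" "(s, (a, p), s2) \<in> transitions A"
      "is_Fresh p \<or> reg p \<in> R"
    from symbolic_configs.step[OF this]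
    show "\<exists>(s', R', P')\<in>symbolic_configs A B. s' = s2 \<and> insert (reg p) R \<subseteq> R' \<and>
          (\<forall>(q', \<sigma>')\<in>P'. \<exists>(q, \<sigma>)\<in>P. \<exists>(q1, (b, p'), q2)\<in>transitions B.
             q1 = q \<and> b = a \<and> q2 = q' \<and> match_enabled p p' \<sigma> \<and> \<sigma>' \<subseteq> match_update p p' \<sigma>)"
      by (rule rev_bexI) (simp, blast)
  qed
qed

lemma symbolic_configs_bounded:
  assumes "session_automaton \<Sigma> A" and "session_automaton \<Sigma>' B"
    and "(s, R, P) \<in> symbolic_configs A B"
  shows "s \<in> states A \<and> R \<subseteq> registers A \<and> P \<subseteq> states B \<times> Pow (registers B \<times> registers A)"
proof -
  have A: "initial A \<in> states A"
    "\<And>s a p s'. (s, (a, p), s') \<in> transitions A \<Longrightarrow> reg p \<in> registers A \<and> s' \<in> states A"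
    and B: "initial B \<in> states B"
    "\<And>s a p s'. (s, (a, p), s') \<in> transitions B \<Longrightarrow> reg p \<in> registers B \<and> s' \<in> states B"
    using assms unfolding session_automaton_def by fast+
  show ?thesis using assms(3)
  proof (induction rule: symbolic_configs.induct)
    case init
    then show ?case using A(1) B(1) by auto
  next
    case (step s R P a p s')
    then show ?case using A(2)[OF step.hyps(2)] B(2) by (fastforce simp: match_update_def)
  qed
qed

section \<open>Coded symbolic configurations\<close>

lemma set_encode_less:
  assumes "S \<subseteq> {..<b}" shows "set_encode S < 2 ^ b"
proof -
  have "set_encode S \<le> (\<Sum>i<b. 2 ^ i)"
    unfolding set_encode_def using assms by (intro sum_mono2) auto
  also have "\<dots> < (2::nat) ^ b" by (induction b) auto
  finally show ?thesis .
qed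

text \<open>The code consists of all indices below \<open>b\<close> that \<open>f\<close> sends into
  \<open>Y\<close>. One application handles one level of nested sets.\<close>

lemma ex_code_image:
  assumes "\<And>y. y \<in> Y \<Longrightarrow> \<exists>c<b. f c = y"
  shows "\<exists>x<2 ^ b. f ` set_decode x = Y"
proof (intro exI conjI)
  let ?S = "{c. c < b \<and> f c \<in> Y}"
  show "set_encode ?S < 2 ^ b" by (rule set_encode_less) auto
  have "finite ?S" by simp
  then show "f ` set_decode (set_encode ?S) = Y" using assms by fastforce
qed

lemma triangle_mono: "m \<le> n \<Longrightarrow> triangle m \<le> triangle n"
  by (induction rule: dec_induct) auto

text \<open>The pair code is \<open>triangle (a + b) + a\<close>, and \<open>triangle\<close> is
  monotone.\<close>

lemma prod_encode_less:
  "a < a' \<Longrightarrow> b < b' \<Longrightarrow> prod_encode (a, b) < prod_encode (a', b')"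
  using triangle_mono[of "a + b" "a' + b'"] by (simp add: prod_encode_def)

text \<open>The decoders are total, so every number denotes some object and the search may range
  over all numbers below a bound.\<close>

definition decode_matching :: "nat \<Rightarrow> (nat \<times> nat) set" where
  "decode_matching c = prod_decode ` set_decode c"

definition decode_threads :: "nat \<Rightarrow> (nat \<times> (nat \<times> nat) set) set" where
  "decode_threads c = (\<lambda>d. (pfst d, decode_matching (psnd d))) ` set_decode c"

definition decode_configs :: "nat \<Rightarrow> (nat \<times> nat set \<times> (nat \<times> (nat \<times> nat) set) set) set" where
  "decode_configs x =
     (\<lambda>m. (pfst m, set_decode (pfst (psnd m)), decode_threads (psnd (psnd m)))) ` set_decode x"

text \<open>Read from the inside out, for states and registers below \<open>n\<close>: the powers of
  2 bound the codes of matchings, of sets of pairs \<open>(q, \<sigma>)\<close> and finally of sets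
  of configurations; \<open>2 ^ n\<close> bounds those of register sets.\<close>

definition config_bound :: "nat \<Rightarrow> nat" where
  "config_bound n =
     2 ^ prod_encode (n, prod_encode (2 ^ n, 2 ^ prod_encode (n, 2 ^ prod_encode (n, n))))"

lemma ex_decode_configs:
  assumes "\<And>s R P. (s, R, P) \<in> X \<Longrightarrow>
    s < n \<and> R \<subseteq> {..<n} \<and> P \<subseteq> {..<n} \<times> Pow ({..<n} \<times> {..<n})"
  shows "\<exists>x<config_bound n. decode_configs x = X"
proof -
  have matching: "\<exists>c<2 ^ prod_encode (n, n). decode_matching c = \<sigma>"
    if "\<sigma> \<subseteq> {..<n} \<times> {..<n}" for \<sigma>
    unfolding decode_matching_def
  proof (rule ex_code_image)
    fix y assume "y \<in> \<sigma>"
    then show "\<exists>c<prod_encode (n, n). prod_decode c = y"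
      using that by (intro exI[of _ "prod_encode y"]) (auto intro: prod_encode_less)
  qed
  have threads: "\<exists>c<2 ^ prod_encode (n, 2 ^ prod_encode (n, n)). decode_threads c = P"
    if P: "P \<subseteq> {..<n} \<times> Pow ({..<n} \<times> {..<n})" for P
    unfolding decode_threads_def
  proof (rule ex_code_image)
    fix y assume "y \<in> P"
    then obtain q \<sigma> where y: "y = (q, \<sigma>)" "q < n" "\<sigma> \<subseteq> {..<n} \<times> {..<n}" using P by blast
    then obtain c where "c < 2 ^ prod_encode (n, n)" "decode_matching c = \<sigma>"
      using matching by blast
    with y show "\<exists>d<prod_encode (n, 2 ^ prod_encode (n, n)). (pfst d, decode_matching (psnd d)) = y"
      by (intro exI[of _ "prod_encode (q, c)"]) (auto intro: prod_encode_less)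
  qed
  show ?thesis unfolding decode_configs_def config_bound_def
  proof (rule ex_code_image)
    fix y assume "y \<in> X"
    then obtain s R P where y: "y = (s, R, P)" "s < n" "R \<subseteq> {..<n}"
      "P \<subseteq> {..<n} \<times> Pow ({..<n} \<times> {..<n})" using assms by (metis prod.collapse)
    then obtain c where c: "c < 2 ^ prod_encode (n, 2 ^ prod_encode (n, n))" "decode_threads c = P"
      using threads by blast
    have "finite R" using y(3) finite_subset by blast
    with y c show "\<exists>m<prod_encode (n, prod_encode (2 ^ n, 2 ^ prod_encode (n, 2 ^ prod_encode (n, n)))).
        (pfst m, set_decode (pfst (psnd m)), decode_threads (psnd (psnd m))) = y"
      by (intro exI[of _ "prod_encode (s, prod_encode (set_encode R, c))"])
        (auto intro!: prod_encode_less set_encode_less)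
  qed
qed

section \<open>Automata as numbers\<close>

abbreviation "code_states a \<equiv> pfst a"
abbreviation "code_registers a \<equiv> pfst (psnd a)"
abbreviation "code_initial a \<equiv> pfst (psnd (psnd a))"
abbreviation "code_finals a \<equiv> pfst (psnd (psnd (psnd a)))"
abbreviation "code_transitions a \<equiv> psnd (psnd (psnd (psnd a)))"

abbreviation "code_source t \<equiv> pfst t"
abbreviation "code_letter t \<equiv> pfst (pfst (psnd t))"
abbreviation "code_op t \<equiv> psnd (pfst (psnd t))"
abbreviation "code_target t \<equiv> psnd (psnd t)"

text \<open>The sum encoding sends \<open>Inl r\<close> to \<open>2 * r\<close> and
  \<open>Inr r\<close> to \<open>2 * r + 1\<close>, so parity gives the kind of an operation and
  halving gives its register.\<close>

lemma even_op_code [simp]: "even (op_code p) \<longleftrightarrow> is_Fresh p"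
  by (cases p) (auto simp: sum_encode_def)

lemma op_code_div_2 [simp]: "op_code p div 2 = reg p"
  by (cases p) (auto simp: sum_encode_def)

lemma transition_code_eq:
  "transition_code e t = prod_encode (fst t,
     prod_encode (prod_encode (e (fst (fst (snd t))), op_code (snd (fst (snd t)))), snd (snd t)))"
  by (metis transition_code.simps prod.collapse)

text \<open>\<open>E\<close> codes the set of letter numbers. Decoded sets are always finite, and a
  set is non-empty iff its code is non-zero.\<close>

definition coded_automaton :: "nat \<Rightarrow> nat \<Rightarrow> bool" where
  "coded_automaton E a \<longleftrightarrow>
     code_states a \<noteq> 0 \<and> code_registers a \<noteq> 0 \<and>
     code_initial a \<in> set_decode (code_states a) \<and>
     (\<forall>s\<in>set_decode (code_finals a). s \<in> set_decode (code_states a)) \<and>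
     (\<forall>t\<in>set_decode (code_transitions a).
        code_source t \<in> set_decode (code_states a) \<and>
        code_letter t \<in> set_decode E \<and>
        code_op t div 2 \<in> set_decode (code_registers a) \<and>
        code_target t \<in> set_decode (code_states a))"

lemma set_decode_eq_empty_iff: "set_decode n = {} \<longleftrightarrow> n = 0"
  by (metis set_decode_inverse set_decode_zero set_encode_empty)

lemma set_encode_eq_0_iff: "finite S \<Longrightarrow> set_encode S = 0 \<longleftrightarrow> S = {}"
  by (metis set_encode_inverse set_decode_zero set_encode_empty)

lemma coded_automaton_aut_code:
  assumes "finite \<Sigma>" and A: "session_automaton \<Sigma> A"
  shows "coded_automaton (set_encode (e ` \<Sigma>)) (aut_code e A)"
proof -
  have "finite (finals A)" using A by (auto simp: session_automaton_def intro: finite_subset)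
  then show ?thesis using assms
    by (auto simp: coded_automaton_def aut_code_def session_automaton_def set_encode_eq_0_iff
        transition_code_eq)
qed

lemma coded_automaton_imp_ex:
  assumes "finite \<Sigma>" and a: "coded_automaton (set_encode (e ` \<Sigma>)) a"
  shows "\<exists>A. session_automaton \<Sigma> A \<and> aut_code e A = a"
proof -
  define op where "op n = (if even n then Fresh (n div 2) else Reuse (n div 2))" for n :: nat
  \<comment> \<open>\<open>inv_into\<close> recovers a letter from its number, because validity of
    the code places that number in the image of \<open>\<Sigma>\<close> under
    \<open>e\<close>.\<close>
  define tr where "tr t = (code_source t, (inv_into \<Sigma> e (code_letter t), op (code_op t)), code_target t)" for t
  have op: "op_code (op n) = n" "reg (op n) = n div 2" for n
    by (auto simp: op_def sum_encode_def)
  let ?A = "\<lparr>states = set_decode (code_states a), registers = set_decode (code_registers a),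
    initial = code_initial a, finals = set_decode (code_finals a),
    transitions = tr ` set_decode (code_transitions a)\<rparr>"
  have letter: "code_letter t \<in> e ` \<Sigma>" if "t \<in> set_decode (code_transitions a)" for t
    using a that \<open>finite \<Sigma>\<close> by (auto simp: coded_automaton_def)
  have "transition_code e (tr t) = t" if "t \<in> set_decode (code_transitions a)" for t
    using f_inv_into_f[OF letter[OF that]] by (simp add: tr_def op)
  then have "transition_code e ` tr ` set_decode (code_transitions a) = set_decode (code_transitions a)"
    by (force simp: image_image)
  then have "aut_code e ?A = a" by (simp add: aut_code_def)
  moreover have "session_automaton \<Sigma> ?A"
    using a inv_into_into[OF letter]
    by (auto simp: session_automaton_def coded_automaton_def tr_def op set_decode_eq_empty_iff)
  ultimately show ?thesis by blast
qed

text \<open>This is \<open>simulation_invariant\<close> on codes: updates and inclusions become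
  membership tests and all quantifiers range over decoded sets, so that the closure rules for
  computable predicates apply.\<close>

definition coded_invariant :: "nat \<Rightarrow> nat \<Rightarrow> nat \<Rightarrow> bool" where
  "coded_invariant a b x \<longleftrightarrow>
     (\<exists>m\<in>set_decode x. pfst m = code_initial a \<and>
        (\<forall>c\<in>set_decode (psnd (psnd m)). pfst c = code_initial b \<and> psnd c = 0)) \<and>
     (\<forall>m\<in>set_decode x. pfst m \<in> set_decode (code_finals a) \<longrightarrow>
        (\<exists>c\<in>set_decode (psnd (psnd m)). pfst c \<in> set_decode (code_finals b))) \<and>
     (\<forall>m\<in>set_decode x. \<forall>t\<in>set_decode (code_transitions a).
        code_source t = pfst m \<longrightarrow>
        even (code_op t) \<or> code_op t div 2 \<in> set_decode (pfst (psnd m)) \<longrightarrow>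
        (\<exists>m'\<in>set_decode x. pfst m' = code_target t \<and>
          code_op t div 2 \<in> set_decode (pfst (psnd m')) \<and>
          (\<forall>r\<in>set_decode (pfst (psnd m)). r \<in> set_decode (pfst (psnd m'))) \<and>
          (\<forall>c'\<in>set_decode (psnd (psnd m')). \<exists>c\<in>set_decode (psnd (psnd m)).
             \<exists>u\<in>set_decode (code_transitions b).
             code_source u = pfst c \<and> code_letter u = code_letter t \<and> code_target u = pfst c' \<and>
             (even (code_op u) \<longleftrightarrow> even (code_op t)) \<and>
             (even (code_op t) \<or>
               prod_encode (code_op u div 2, code_op t div 2) \<in> set_decode (psnd c)) \<and>
             (\<forall>z\<in>set_decode (psnd c').
                z = prod_encode (code_op u div 2, code_op t div 2) \<or>
                z \<in> set_decode (psnd c) \<and>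
                (even (code_op t) \<longrightarrow>
                  pfst z \<noteq> code_op u div 2 \<and> psnd z \<noteq> code_op t div 2)))))"

lemma mem_decode_matching: "z \<in> decode_matching c \<longleftrightarrow> prod_encode z \<in> set_decode c"
  unfolding decode_matching_def by (metis image_iff prod_decode_inverse prod_encode_inverse)

lemma decode_matching_eq_empty_iff: "decode_matching c = {} \<longleftrightarrow> c = 0"
  by (simp add: decode_matching_def set_decode_eq_empty_iff)

lemma decode_matching_subset_match_update_iff:
  "decode_matching c' \<subseteq> match_update p p' (decode_matching c) \<longleftrightarrow>
     (\<forall>z\<in>set_decode c'. z = prod_encode (reg p', reg p) \<or>
        z \<in> set_decode c \<and> (is_Fresh p \<longrightarrow> pfst z \<noteq> reg p' \<and> psnd z \<noteq> reg p))"
proof -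
  have "prod_decode z \<in> match_update p p' (decode_matching c) \<longleftrightarrow>
      z = prod_encode (reg p', reg p) \<or>
      z \<in> set_decode c \<and> (is_Fresh p \<longrightarrow> pfst z \<noteq> reg p' \<and> psnd z \<noteq> reg p)" for z
  proof -
    obtain x y where "z = prod_encode (x, y)" by (metis prod_encode_pfst_psnd)
    then show ?thesis by (auto simp: match_update_def mem_decode_matching prod_encode_eq)
  qed
  then show ?thesis by (simp add: decode_matching_def[of c'] image_subset_iff)
qed

lemma coded_invariant_iff:
  assumes "inj_on e \<Sigma>" and A: "session_automaton \<Sigma> A" and B: "session_automaton \<Sigma> B"
  shows "coded_invariant (aut_code e A) (aut_code e B) x \<longleftrightarrow>
    simulation_invariant A B (decode_configs x)"
proof -
  have fin: "finite (finals A)" "finite (finals B)" "finite (transitions A)" "finite (transitions B)"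
    using A B by (auto simp: session_automaton_def intro: finite_subset)
  \<comment> \<open>The letters of both automata lie in \<open>\<Sigma>\<close>, where
    \<open>e\<close> is injective, so comparing numbers is comparing letters.\<close>
  have letter: "e (fst (fst (snd u))) = e (fst (fst (snd t))) \<longleftrightarrow> fst (fst (snd u)) = fst (fst (snd t))"
    if "u \<in> transitions B" "t \<in> transitions A" for u t
  proof -
    have "fst (fst (snd u)) \<in> \<Sigma>" "fst (fst (snd t)) \<in> \<Sigma>"
      using A B that unfolding session_automaton_def by fastforce+
    then show ?thesis using inj_on_eq_iff[OF assms(1)] by blast
  qed
  show ?thesis
    unfolding coded_invariant_def simulation_invariant_def
    by (simp add: aut_code_def fin decode_configs_def decode_threads_def transition_code_eq
        case_prod_beta decode_matching_eq_empty_iff decode_matching_subset_match_update_iff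
        match_enabled_def mem_decode_matching letter subset_iff[of "set_decode _"] Ball_def[symmetric] conj_assoc
        cong: ball_cong bex_cong conj_cong imp_cong)
qed

lemma coded_inclusion:
  assumes "infinite D" and "inj_on e \<Sigma>" and A: "session_automaton \<Sigma> A" and B: "session_automaton \<Sigma> B"
  shows "language \<Sigma> D A \<subseteq> language \<Sigma> D B \<longleftrightarrow>
    (\<exists>x<config_bound (prod_encode (aut_code e A, aut_code e B)).
      coded_invariant (aut_code e A) (aut_code e B) x)"
proof
  assume "\<exists>x<config_bound (prod_encode (aut_code e A, aut_code e B)).
      coded_invariant (aut_code e A) (aut_code e B) x"
  then show "language \<Sigma> D A \<subseteq> language \<Sigma> D B"
    using coded_invariant_iff[OF assms(2-4)] language_subset_if_simulation_invariant by blast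
next
  assume incl: "language \<Sigma> D A \<subseteq> language \<Sigma> D B"
  \<comment> \<open>The code of the instance itself bounds all states and registers: elements of a
    set are smaller than its code, and components of a pair are at most the code of the
    pair.\<close>
  define n where "n = prod_encode (aut_code e A, aut_code e B)"
  have fin: "finite (states A)" "finite (registers A)" "finite (states B)" "finite (registers B)"
    using A B by (auto simp: session_automaton_def)
  have less: "i < set_encode S" if "finite S" "i \<in> S" for i S
    using mem_set_decode_less[of i "set_encode S"] that by simp
  have "set_encode (states A) \<le> n" "set_encode (registers A) \<le> n"
    "set_encode (states B) \<le> n" "set_encode (registers B) \<le> n"
    unfolding n_def aut_code_def by (meson le_prod_encode_1 le_prod_encode_2 order_trans)+
  then have sub: "states A \<subseteq> {..<n}" "registers A \<subseteq> {..<n}" "states B \<subseteq> {..<n}" "registers B \<subseteq> {..<n}"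
    using less fin by (fastforce intro: order_less_le_trans)+
  have "\<exists>x<config_bound n. decode_configs x = symbolic_configs A B"
  proof (rule ex_decode_configs)
    fix s R P assume "(s, R, P) \<in> symbolic_configs A B"
    from symbolic_configs_bounded[OF A B this] sub
    show "s < n \<and> R \<subseteq> {..<n} \<and> P \<subseteq> {..<n} \<times> Pow ({..<n} \<times> {..<n})"
      by blast
  qed
  moreover have "simulation_invariant A B (symbolic_configs A B)"
    using A assms(1) incl by (rule simulation_invariant_symbolic_configs)
  ultimately show "\<exists>x<config_bound (prod_encode (aut_code e A, aut_code e B)).
      coded_invariant (aut_code e A) (aut_code e B) x"
    unfolding coded_invariant_iff[OF assms(2-4)] n_def by metis
qed

section \<open>Decidability of inclusion on codes\<close>

lemmas computable_intros =
  computable_var computable_const computable_prod_encode computable_pfst computable_psnd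
  computable_div2 computable_power
  computable_pred_not computable_pred_conj computable_pred_disj computable_pred_imp
  computable_pred_iff computable_pred_ex_less computable_pred_bex_set_decode
  computable_pred_ball_set_decode computable_pred_mem_set_decode computable_pred_even
  computable_pred_eq

theorem theorem3p9:
  fixes \<Sigma> :: "'a set" and D :: "'d set" and e :: "'a \<Rightarrow> nat"
  assumes "finite \<Sigma>" and "\<Sigma> \<noteq> {}" and "infinite D" and "inj_on e \<Sigma>"
  shows "decidable {prod_encode (aut_code e A, aut_code e B) | A B.
    session_automaton \<Sigma> A \<and> session_automaton \<Sigma> B \<and>
    language \<Sigma> D A \<subseteq> language \<Sigma> D B}"
proof (rule decidable_if_computable_pred, rule computable_pred_cong)
  let ?E = "set_encode (e ` \<Sigma>)"
  \<comment> \<open>Once unfolded, the formula consists of constructs that have a closure rule. With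
    \<open>\<Sigma>\<close> and \<open>e\<close> fixed, \<open>?E\<close> is a constant.\<close>
  show "computable_pred (\<lambda>\<rho>. coded_automaton ?E (pfst (\<rho> 0)) \<and> coded_automaton ?E (psnd (\<rho> 0)) \<and>
      (\<exists>x<config_bound (\<rho> 0). coded_invariant (pfst (\<rho> 0)) (psnd (\<rho> 0)) x))"
    unfolding coded_automaton_def coded_invariant_def config_bound_def
    by (intro computable_intros)
  fix \<rho> :: "nat \<Rightarrow> nat"
  obtain a b where n: "\<rho> 0 = prod_encode (a, b)" by (metis prod_decode_inverse prod.collapse)
  show "coded_automaton ?E (pfst (\<rho> 0)) \<and> coded_automaton ?E (psnd (\<rho> 0)) \<and>
      (\<exists>x<config_bound (\<rho> 0). coded_invariant (pfst (\<rho> 0)) (psnd (\<rho> 0)) x) \<longleftrightarrow>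
    \<rho> 0 \<in> {prod_encode (aut_code e A, aut_code e B) | A B.
    session_automaton \<Sigma> A \<and> session_automaton \<Sigma> B \<and> language \<Sigma> D A \<subseteq> language \<Sigma> D B}"
    (is "?L \<longleftrightarrow> ?R")
  proof
    assume ?L
    then have "coded_automaton ?E a" "coded_automaton ?E b"
      and inv: "\<exists>x<config_bound (prod_encode (a, b)). coded_invariant a b x" by (auto simp: n)
    then obtain A B where AB: "session_automaton \<Sigma> A" "aut_code e A = a"
        "session_automaton \<Sigma> B" "aut_code e B = b"
      using coded_automaton_imp_ex[OF assms(1)] by metis
    then have "language \<Sigma> D A \<subseteq> language \<Sigma> D B"
      using inv coded_inclusion[OF assms(3,4) AB(1,3)] by simp
    then show ?R using AB n by blast
  next
    assume ?R
    then obtain A B where AB: "session_automaton \<Sigma> A" "session_automaton \<Sigma> B"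
        "a = aut_code e A" "b = aut_code e B" "language \<Sigma> D A \<subseteq> language \<Sigma> D B"
      using n by (auto simp: prod_encode_eq)
    then show ?L
      using coded_inclusion[OF assms(3,4) AB(1,2)] coded_automaton_aut_code[OF assms(1)]
      by (simp add: n)
  qed
qed

end
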